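(* Let $X_1,\dots,X_m$ be identically distributed (not necessarily independent) from $F$, an absolutely continuous unimodal distribution on $\mathbb{R}$ with density $f$ and a unique mode $\theta_0$. Split the sample into two disjoint, almost equally sized sub-samples $S_1$ and $S_2$ with $|S_1|=m-n$, $|S_2|=n$, and let $\widehat\theta_1$ be any consistent estimate of the mode computed from $S_1$ only. For $\alpha\in(0,1)$ and $\rho>1$ let $$\widehat{\mathrm{CS}}_{n,\alpha}^{\mathrm{Ed}_E,\rho}=\left\{\theta\in\mathbb{R}\;:\;\frac1n\left(\frac{\rho-1}{\rho+1}\right)\sum_{i\in S_2}\left|\frac{X_i-\theta}{X_i-\widehat\theta_1}\right|^{1/\rho}<\frac1\alpha\right\}.$$ Then for all $n\ge1$, all $\alpha\in(0,1)$ and all $\rho>1$, $$\mathbb{P}_F\big(\theta_0\in\widehat{\mathrm{CS}}_{n,\alpha}^{\mathrm{Ed}_E,\rho}\big)\ge1-\alpha.$$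
   Context: Unimodal with mode $\theta_0$: $F$ is convex on $(-\infty,\theta_0]$ and concave on $[\theta_0,\infty)$. The sum over $i\in S_2$ runs over the indices of the observations in the sub-sample $S_2$.
   Formalization: Each observation X_i with i in S_2 is additionally assumed independent of the sub-sample S_1; with arbitrary dependence across the split the claim fails (e.g. X_1 = X_2, m = 2, estimate X_1 + ε). Dependence within S_1 and within S_2 stays arbitrary. *)

theory Defs
  imports "HOL-Probability.Probability"
begin

text \<open>Unimodality is a property of the distribution function, not of the density: it is
  convex to the left of the mode and concave to the right of it.\<close>

definition is_mode :: "real measure \<Rightarrow> real \<Rightarrow> bool" where
  "is_mode F \<theta> \<longleftrightarrow> convex_on {..\<theta>} (cdf F) \<and> concave_on {\<theta>..} (cdf F)"

definition unique_mode :: "real measure \<Rightarrow> real \<Rightarrow> bool" where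
  "unique_mode F \<theta>\<^sub>0 \<longleftrightarrow> is_mode F \<theta>\<^sub>0 \<and> (\<forall>\<theta>. is_mode F \<theta> \<longrightarrow> \<theta> = \<theta>\<^sub>0)"

definition has_density :: "real measure \<Rightarrow> (real \<Rightarrow> real) \<Rightarrow> bool" where
  "has_density F f \<longleftrightarrow>
     f \<in> borel_measurable borel \<and> (\<forall>x. 0 \<le> f x) \<and> F = density lborel (\<lambda>x. ennreal (f x))"

text \<open>A split of the index set \<open>{1..m}\<close> into two parts whose sizes differ by at most one.\<close>

definition sample_split :: "nat \<Rightarrow> nat set \<Rightarrow> nat set \<Rightarrow> bool" where
  "sample_split m S\<^sub>1 S\<^sub>2 \<longleftrightarrow>
     S\<^sub>1 \<inter> S\<^sub>2 = {} \<and> S\<^sub>1 \<union> S\<^sub>2 = {1..m} \<and> \<bar>int (card S\<^sub>1) - int (card S\<^sub>2)\<bar> \<le> 1"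

definition subsample :: "nat set \<Rightarrow> (nat \<Rightarrow> 'a \<Rightarrow> real) \<Rightarrow> 'a \<Rightarrow> nat \<Rightarrow> real" where
  "subsample S X \<omega> = (\<lambda>i\<in>S. X i \<omega>)"

text \<open>Convergence in probability to a constant.\<close>

definition consistent :: "'a measure \<Rightarrow> (nat \<Rightarrow> 'a \<Rightarrow> real) \<Rightarrow> real \<Rightarrow> bool" where
  "consistent M \<theta>hat \<theta> \<longleftrightarrow>
     (\<forall>\<epsilon>>0. (\<lambda>m. measure M {\<omega> \<in> space M. \<epsilon> < \<bar>\<theta>hat m \<omega> - \<theta>\<bar>}) \<longlonglongrightarrow> 0)"

text \<open>The observations are \<open>x i\<close> with \<open>i \<in> S\<^sub>2\<close>, and \<open>t\<close> is the preliminary estimate. A term with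
  \<open>x i = t\<close> counts as \<open>0\<close>. If \<open>x i\<close> has a Lebesgue density and is independent of \<open>t\<close>, this
  happens with probability \<open>0\<close>, so the convention does not affect coverage probabilities.\<close>

definition edelman_CS ::
    "nat set \<Rightarrow> nat \<Rightarrow> real \<Rightarrow> real \<Rightarrow> (nat \<Rightarrow> real) \<Rightarrow> real \<Rightarrow> real set" where
  "edelman_CS S\<^sub>2 n \<alpha> \<rho> x t =
     {\<theta>. 1 / real n * ((\<rho> - 1) / (\<rho> + 1))
          * (\<Sum>i\<in>S\<^sub>2. \<bar>(x i - \<theta>) / (x i - t)\<bar> powr (1 / \<rho>)) < 1 / \<alpha>}"

end

theory Submission
  imports Defs
begin

text \<open>Write \<open>s = 1 / \<rho>\<close>. By Markov's inequality it suffices that each summand has expectation at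
  most \<open>(\<rho> + 1) / (\<rho> - 1) = (1 + s) / (1 - s)\<close>, and by independence the estimate may be replaced
  by a constant \<open>t\<close>. Put the mode at 0. By concavity of the distribution function, the law
  restricted to the positive half-line is a limit of mixtures of uniform distributions on intervals
  \<open>(0, b)\<close>, so it is enough to bound the mean of \<open>\<bar>x / (x - t)\<bar> powr s\<close> over such an interval; the
  negative half-line is symmetric. There the numerator is at most \<open>b powr s\<close>, and the integral of
  \<open>\<bar>x - t\<bar> powr (-s)\<close> is largest when \<open>t = b / 2\<close>. This gives the mean bound
  \<open>2 powr s / (1 - s)\<close>, and \<open>2 powr s \<le> 1 + s\<close> by convexity.\<close>

section \<open>The singular kernel on intervals\<close>

text \<open>The excess of \<open>\<bar>v\<bar> powr (-s)\<close> over its level at distance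
  \<open>r\<close> vanishes off \<open>{-r..r}\<close> and is even, so an elementary integral on
  \<open>{0..r}\<close> is doubled. It is the part of the rearrangement bound below that is
  independent of the set.\<close>

lemma has_integral_abs_powr_excess:
  fixes r s :: real
  assumes "0 < r" "0 < s" "s < 1"
  shows "((\<lambda>v. max 0 (\<bar>v\<bar> powr (-s) - r powr (-s))) has_integral
           2 * (r powr (1 - s) / (1 - s) - r powr (1 - s))) UNIV"
proof -
  let ?I = "r powr (1 - s) / (1 - s) - r powr (1 - s)"
  let ?f = "\<lambda>v::real. max 0 (\<bar>v\<bar> powr (-s) - r powr (-s))"
  have "((\<lambda>v. v powr (-s) - r powr (-s)) has_integral
          r powr (-s + 1) / (-s + 1) - r * r powr (-s)) {0..r}"
    using has_integral_diff[OF has_integral_powr_from_0[of "-s" r] has_integral_const_real[of "r powr (-s)" 0 r]]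
      assms by simp
  moreover have "r * r powr (-s) = r powr (1 - s)"
    using assms powr_add[of r 1 "-s"] by simp
  ultimately have "((\<lambda>v. v powr (-s) - r powr (-s)) has_integral ?I) {0..r}"
    by simp
  then have pos: "(?f has_integral ?I) {0..r}"
  \<comment> \<open>Since \<open>0 powr (-s) = 0\<close>, the two integrands differ at
    \<open>v = 0\<close>; one point is negligible.\<close>
  proof (rule has_integral_spike[OF negligible_sing, rotated])
    fix v assume "v \<in> {0..r} - {0}"
    then have "0 < v" "v \<le> r" by auto
    then show "?f v = v powr (-s) - r powr (-s)"
      using assms powr_mono2'[of "-s" v r] by auto
  qed
  then have neg: "(?f has_integral ?I) {-r..0}"
    using has_integral_reflect_real[where f = ?f and i = ?I and a = 0 and b = r]
    by (simp only: abs_minus_cancel minus_zero)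
  have "(?f has_integral ?I + ?I) {-r..r}"
    by (rule has_integral_combine[OF _ _ neg pos]) (use assms in auto)
  then have "(?f has_integral ?I + ?I) UNIV"
  proof (rule has_integral_on_superset)
    fix v assume "v \<notin> {-r..r}"
    then have "\<bar>v\<bar> powr (-s) \<le> r powr (-s)"
      using assms by (intro powr_mono2') auto
    then show "?f v = 0" by simp
  qed simp
  then show ?thesis by simp
qed

text \<open>Among the sets of given length, the interval centred at the singularity maximises the integral.\<close>

lemma nn_integral_abs_powr_le:
  fixes s b c :: real
  assumes s: "0 < s" "s < 1" and b: "0 < b"
    and A[measurable]: "A \<in> sets borel" and Ab: "emeasure lborel A \<le> ennreal b"
  shows "(\<integral>\<^sup>+x. ennreal (\<bar>x - c\<bar> powr (-s)) * indicator A x \<partial>lborel)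
           \<le> ennreal (2 powr s * b powr (1 - s) / (1 - s))"
proof -
  \<comment> \<open>The interval of radius \<open>r\<close> about \<open>c\<close> has length
    exactly \<open>b\<close>.\<close>
  define r where "r = b / 2"
  have r: "0 < r" "b = 2 * r" using b by (auto simp: r_def)
  let ?f = "\<lambda>v::real. max 0 (\<bar>v\<bar> powr (-s) - r powr (-s))"
  let ?I = "2 * (r powr (1 - s) / (1 - s) - r powr (1 - s))"
  have I0: "0 \<le> ?I"
    using has_integral_nonneg[OF has_integral_abs_powr_excess[OF r(1) s]] by simp
  \<comment> \<open>The kernel is at most its excess plus the level \<open>r powr (-s)\<close>. The
    indicator is kept on the level only, which costs nothing when \<open>A\<close> is the centred
    interval.\<close>
  have "(\<integral>\<^sup>+x. ennreal (\<bar>x - c\<bar> powr (-s)) * indicator A x \<partial>lborel)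
      \<le> (\<integral>\<^sup>+x. ennreal (?f (x - c)) + ennreal (r powr (-s)) * indicator A x \<partial>lborel)"
  proof (intro nn_integral_mono)
    fix x :: real
    have "ennreal (\<bar>x - c\<bar> powr (-s)) \<le> ennreal (?f (x - c) + r powr (-s))"
      by (intro ennreal_leI) auto
    also have "\<dots> = ennreal (?f (x - c)) + ennreal (r powr (-s))"
      by (rule ennreal_plus) auto
    finally show "ennreal (\<bar>x - c\<bar> powr (-s)) * indicator A x
        \<le> ennreal (?f (x - c)) + ennreal (r powr (-s)) * indicator A x"
      by (auto split: split_indicator)
  qed
  also have "\<dots> = (\<integral>\<^sup>+x. ennreal (?f (x - c)) \<partial>lborel) + ennreal (r powr (-s)) * emeasure lborel A"
    by (subst nn_integral_add) (auto simp: nn_integral_cmult_indicator)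
  also have "(\<integral>\<^sup>+x. ennreal (?f (x - c)) \<partial>lborel) = (\<integral>\<^sup>+x. ennreal (?f x) \<partial>lborel)"
    by (subst nn_integral_real_affine[where c = 1 and t = c]) auto
  also have "\<dots> = ennreal ?I"
    using has_integral_abs_powr_excess[OF r(1) s]
    by (intro nn_integral_has_integral_lborel) auto
  also have "ennreal ?I + ennreal (r powr (-s)) * emeasure lborel A
      \<le> ennreal ?I + ennreal (r powr (-s)) * ennreal b"
    by (intro add_left_mono mult_left_mono Ab) auto
  also have "\<dots> = ennreal (?I + r powr (-s) * b)"
    using I0 b by (simp add: ennreal_mult[symmetric] ennreal_plus[symmetric] del: ennreal_plus)
  also have "?I + r powr (-s) * b = 2 powr s * b powr (1 - s) / (1 - s)"
  proof -
    have "r powr (-s) * r = r powr (1 - s)"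
      using r powr_add[of r 1 "-s"] by simp
    then have "?I + r powr (-s) * b = 2 * r powr (1 - s) / (1 - s)"
      by (simp add: r(2))
    moreover have "2 powr s * b powr (1 - s) = 2 * r powr (1 - s)"
      using r by (simp add: powr_mult powr_add[symmetric] flip: mult.assoc)
    ultimately show ?thesis by simp
  qed
  finally show ?thesis .
qed

text \<open>The factors \<open>b powr s\<close> from the numerator and \<open>b powr (1 - s)\<close>
  from the singular factor multiply to \<open>b\<close>. A bound linear in the length, with a
  constant free of \<open>c\<close>, survives mixing over intervals.\<close>

lemma nn_integral_ratio_powr_le:
  fixes s b c :: real
  assumes s: "0 < s" "s < 1" and b: "0 < b"
  shows "(\<integral>\<^sup>+x. ennreal (\<bar>x / (x - c)\<bar> powr s) * indicator {0<..b} x \<partial>lborel)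
           \<le> ennreal (2 powr s / (1 - s)) * ennreal b"
proof -
  have "(\<integral>\<^sup>+x. ennreal (\<bar>x / (x - c)\<bar> powr s) * indicator {0<..b} x \<partial>lborel)
      \<le> (\<integral>\<^sup>+x. ennreal (b powr s) * (ennreal (\<bar>x - c\<bar> powr (-s)) * indicator {0<..b} x) \<partial>lborel)"
  proof (intro nn_integral_mono)
    fix x :: real
    \<comment> \<open>At \<open>x = c\<close> both sides are 0, by the conventions for division by 0
      and for \<open>0 powr\<close>.\<close>
    have "\<bar>x / (x - c)\<bar> powr s \<le> b powr s * \<bar>x - c\<bar> powr (-s)" if "0 < x" "x \<le> b"
      using that s by (auto simp: abs_divide powr_divide powr_minus field_simps
          intro!: divide_right_mono powr_mono2)
    then show "ennreal (\<bar>x / (x - c)\<bar> powr s) * indicator {0<..b} x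
        \<le> ennreal (b powr s) * (ennreal (\<bar>x - c\<bar> powr (-s)) * indicator {0<..b} x)"
      by (auto simp: ennreal_mult[symmetric] split: split_indicator intro!: ennreal_leI)
  qed
  also have "\<dots> = ennreal (b powr s) * (\<integral>\<^sup>+x. ennreal (\<bar>x - c\<bar> powr (-s)) * indicator {0<..b} x \<partial>lborel)"
    by (rule nn_integral_cmult) measurable
  also have "\<dots> \<le> ennreal (b powr s) * ennreal (2 powr s * b powr (1 - s) / (1 - s))"
    using s b by (intro mult_left_mono nn_integral_abs_powr_le) auto
  also have "\<dots> = ennreal (2 powr s / (1 - s)) * ennreal b"
  proof -
    have "b powr s * b powr (1 - s) = b"
      using b by (simp add: powr_add[symmetric])
    then have "b powr s * (2 powr s * b powr (1 - s) / (1 - s)) = 2 powr s / (1 - s) * b"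
      by (metis (no_types, lifting) mult.commute mult.left_commute times_divide_eq_right)
    then show ?thesis
      using s b by (simp add: ennreal_mult[symmetric] del: times_divide_eq_right times_divide_eq_left)
  qed
  finally show ?thesis .
qed

section \<open>From intervals to decreasing weights\<close>

text \<open>Such a set is an interval with left end 0. If it is bounded, it lies between
  \<open>{0<..<b}\<close> and \<open>{0<..b}\<close>, which have equal length; if not, its measure
  is infinite and the right side is \<open>\<top>\<close> because \<open>0 < C\<close>.\<close>

lemma nn_integral_downset_le:
  fixes k :: "real \<Rightarrow> ennreal" and C :: real
  assumes C: "0 < C"
    and k: "\<And>b. 0 < b \<Longrightarrow> (\<integral>\<^sup>+x. k x * indicator {0<..b} x \<partial>lborel) \<le> ennreal C * ennreal b"
    and A[measurable]: "A \<in> sets borel" and pos: "A \<subseteq> {0<..}"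
    and down: "\<And>x y. x \<in> A \<Longrightarrow> 0 < y \<Longrightarrow> y \<le> x \<Longrightarrow> y \<in> A"
  shows "(\<integral>\<^sup>+x. k x * indicator A x \<partial>lborel) \<le> ennreal C * emeasure lborel A"
proof (cases "A = {}")
  case False
  show ?thesis
  proof (cases "bdd_above A")
    case True
    define b where "b = Sup A"
    have up: "A \<subseteq> {0<..b}"
      using pos True by (auto simp: b_def intro: cSup_upper)
    with False have "0 < b" by fastforce
    have lo: "{0<..<b} \<subseteq> A"
      using False True down less_cSup_iff[of A] by (force simp: b_def)
    have "(\<integral>\<^sup>+x. k x * indicator A x \<partial>lborel) \<le> (\<integral>\<^sup>+x. k x * indicator {0<..b} x \<partial>lborel)"
      using up by (intro nn_integral_mono mult_left_mono) (auto split: split_indicator)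
    also have "\<dots> \<le> ennreal C * ennreal b"
      by (rule k[OF \<open>0 < b\<close>])
    also have "ennreal b = emeasure lborel {0<..<b}"
      using \<open>0 < b\<close> by simp
    also have "ennreal C * emeasure lborel {0<..<b} \<le> ennreal C * emeasure lborel A"
      using lo by (intro mult_left_mono emeasure_mono) auto
    finally show ?thesis .
  next
    case unbounded: False
    have "ennreal n \<le> emeasure lborel A" for n :: nat
    proof -
      obtain x where "x \<in> A" "real n < x"
        using unbounded by (meson bdd_above.I not_le)
      then have "{0<..real n} \<subseteq> A" using down by auto
      from emeasure_mono[OF this, of lborel] show ?thesis by simp
    qed
    then have "emeasure lborel A = \<top>"
      by (metis ennreal_Ex_less_of_nat ennreal_of_nat_eq_real_of_nat not_le top.not_eq_extremum)
    with C show ?thesis by (simp add: ennreal_mult_top)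
  qed
qed simp

text \<open>Layer cake: each superlevel set of \<open>g\<close> in the positive half-line is an interval starting at 0.\<close>

lemma nn_integral_antimono_weight_le:
  fixes k :: "real \<Rightarrow> ennreal" and C :: real and g :: "real \<Rightarrow> real"
  assumes C: "0 < C"
    and k: "\<And>b. 0 < b \<Longrightarrow> (\<integral>\<^sup>+x. k x * indicator {0<..b} x \<partial>lborel) \<le> ennreal C * ennreal b"
    and [measurable]: "k \<in> borel_measurable borel" "g \<in> borel_measurable borel"
    and g0: "\<And>x. 0 \<le> g x"
    and anti: "\<And>x y. 0 < x \<Longrightarrow> x \<le> y \<Longrightarrow> g y \<le> g x"
  shows "(\<integral>\<^sup>+x. k x * indicator {0<..} x * ennreal (g x) \<partial>lborel)
           \<le> ennreal C * (\<integral>\<^sup>+x. indicator {0<..} x * ennreal (g x) \<partial>lborel)"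
proof -
  let ?A = "\<lambda>r. {x. 0 < x \<and> 0 \<le> r \<and> r < g x}"
  have layer: "ennreal (g x) = (\<integral>\<^sup>+r. indicator {r. 0 \<le> r \<and> r < g x} r \<partial>lborel)" for x
  proof -
    have "{r. 0 \<le> r \<and> r < g x} = {0..<g x}" by auto
    then show ?thesis using g0[of x] by simp
  qed
  \<comment> \<open>The identity is applied twice: with \<open>h = k\<close> to reach the superlevel
    sets, and with \<open>h = 1\<close> to reassemble their lengths.\<close>
  have cake: "(\<integral>\<^sup>+x. h x * indicator {0<..} x * ennreal (g x) \<partial>lborel)
      = (\<integral>\<^sup>+r. \<integral>\<^sup>+x. h x * indicator (?A r) x \<partial>lborel \<partial>lborel)"
    if [measurable]: "h \<in> borel_measurable borel" for h :: "real \<Rightarrow> ennreal"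
  proof -
    have "(\<integral>\<^sup>+x. h x * indicator {0<..} x * ennreal (g x) \<partial>lborel)
        = (\<integral>\<^sup>+x. \<integral>\<^sup>+r. h x * indicator (?A r) x \<partial>lborel \<partial>lborel)"
      unfolding layer
      by (subst nn_integral_cmult[symmetric])
         (auto intro!: nn_integral_cong split: split_indicator)
    also have "\<dots> = (\<integral>\<^sup>+r. \<integral>\<^sup>+x. h x * indicator (?A r) x \<partial>lborel \<partial>lborel)"
      by (rule lborel_pair.Fubini') measurable
    finally show ?thesis .
  qed
  have "(\<integral>\<^sup>+x. k x * indicator {0<..} x * ennreal (g x) \<partial>lborel)
      = (\<integral>\<^sup>+r. \<integral>\<^sup>+x. k x * indicator (?A r) x \<partial>lborel \<partial>lborel)"
    by (rule cake) simp
  also have "\<dots> \<le> (\<integral>\<^sup>+r. ennreal C * emeasure lborel (?A r) \<partial>lborel)"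
    by (intro nn_integral_mono nn_integral_downset_le[OF C k])
       (auto intro: less_le_trans dest: anti)
  also have "\<dots> = ennreal C * (\<integral>\<^sup>+r. \<integral>\<^sup>+x. 1 * indicator (?A r) x \<partial>lborel \<partial>lborel)"
    by (subst nn_integral_cmult[symmetric]) auto
  also have "(\<integral>\<^sup>+r. \<integral>\<^sup>+x. 1 * indicator (?A r) x \<partial>lborel \<partial>lborel)
      = (\<integral>\<^sup>+x. indicator {0<..} x * ennreal (g x) \<partial>lborel)"
    using cake[of "\<lambda>_. 1"] by simp
  finally show ?thesis .
qed

section \<open>From decreasing weights to laws, by smoothing\<close>

text \<open>Supplies joint measurability of the moving windows \<open>{y - h..<y}\<close> for the
  exchanges of integrals below.\<close>

lemma pred_atLeastLessThan [measurable (raw)]: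
  fixes a b c :: "'a \<Rightarrow> real"
  assumes [measurable]: "a \<in> borel_measurable M" "b \<in> borel_measurable M" "c \<in> borel_measurable M"
  shows "Measurable.pred M (\<lambda>x. c x \<in> {a x..<b x})"
  by simp

text \<open>Convolving \<open>\<mu>\<close> with the uniform distribution on \<open>[-h, 0]\<close> produces a monotone density.\<close>

lemma nn_integral_smoothed_le:
  fixes \<mu> :: "real measure" and k :: "real \<Rightarrow> ennreal" and C h :: real
  assumes \<mu>: "finite_measure \<mu>" and sets[measurable_cong]: "sets \<mu> = sets borel"
    and C: "0 < C" and h: "0 < h"
    and k: "\<And>b. 0 < b \<Longrightarrow> (\<integral>\<^sup>+x. k x * indicator {0<..b} x \<partial>lborel) \<le> ennreal C * ennreal b"
    and k_meas[measurable]: "k \<in> borel_measurable borel"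
    and incr: "\<And>x y. 0 < x \<Longrightarrow> x \<le> y \<Longrightarrow> measure \<mu> {y<..y + h} \<le> measure \<mu> {x<..x + h}"
  shows "(\<integral>\<^sup>+y. \<integral>\<^sup>+x. k x * indicator {0<..} x * indicator {y - h..<y} x \<partial>lborel \<partial>\<mu>)
           \<le> ennreal C * (ennreal h * emeasure \<mu> {0<..})"
proof -
  interpret finite_measure \<mu> by fact
  interpret pair_sigma_finite lborel \<mu> ..
  let ?g = "\<lambda>x. measure \<mu> {x<..x + h}"
  \<comment> \<open>The half-open shape of the window makes its mass over \<open>y\<close> the
    measure of \<open>{x<..x + h}\<close>, an increment of the distribution function.\<close>
  have inner: "ennreal (?g x) = (\<integral>\<^sup>+y. indicator {y - h..<y} x \<partial>\<mu>)" for x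
  proof -
    have "(\<integral>\<^sup>+y. indicator {y - h..<y} x \<partial>\<mu>) = (\<integral>\<^sup>+y. indicator {x<..x + h} y \<partial>\<mu>)"
      by (intro nn_integral_cong) (auto split: split_indicator)
    then show ?thesis by (simp add: emeasure_eq_measure)
  qed
  have "?g = (\<lambda>x. enn2real (\<integral>\<^sup>+y. indicator {y - h..<y} x \<partial>\<mu>))"
    by (simp flip: inner)
  also have "\<dots> \<in> borel_measurable borel" by measurable
  finally have g[measurable]: "?g \<in> borel_measurable borel" .
  have swap: "(\<integral>\<^sup>+y. \<integral>\<^sup>+x. q x * indicator {0<..} x * indicator {y - h..<y} x \<partial>lborel \<partial>\<mu>)
      = (\<integral>\<^sup>+x. q x * indicator {0<..} x * ennreal (?g x) \<partial>lborel)"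
    if [measurable]: "q \<in> borel_measurable borel" for q :: "real \<Rightarrow> ennreal"
    unfolding inner
    by (subst Fubini') (auto simp: nn_integral_cmult)
  have "(\<integral>\<^sup>+y. \<integral>\<^sup>+x. k x * indicator {0<..} x * indicator {y - h..<y} x \<partial>lborel \<partial>\<mu>)
      = (\<integral>\<^sup>+x. k x * indicator {0<..} x * ennreal (?g x) \<partial>lborel)"
    by (rule swap) simp
  also have "\<dots> \<le> ennreal C * (\<integral>\<^sup>+x. indicator {0<..} x * ennreal (?g x) \<partial>lborel)"
    by (rule nn_integral_antimono_weight_le[OF C k k_meas g _ incr]) auto
  also have "(\<integral>\<^sup>+x. indicator {0<..} x * ennreal (?g x) \<partial>lborel)
      = (\<integral>\<^sup>+y. \<integral>\<^sup>+x. indicator {0<..} x * indicator {y - h..<y} x \<partial>lborel \<partial>\<mu>)"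
    using swap[of "\<lambda>_. 1"] by simp
  \<comment> \<open>The window lies to the left of \<open>y\<close>, so it misses the positive
    half-line when \<open>y \<le> 0\<close>: smoothing moves no mass into that half-line.\<close>
  also have "\<dots> \<le> (\<integral>\<^sup>+y. ennreal h * indicator {0<..} y \<partial>\<mu>)"
  proof (intro nn_integral_mono)
    fix y
    have "(\<integral>\<^sup>+x. indicator {0<..} x * indicator {y - h..<y} x \<partial>lborel)
        \<le> (\<integral>\<^sup>+x. indicator {0<..} y * indicator {y - h..<y} x \<partial>lborel)"
      by (intro nn_integral_mono) (auto split: split_indicator)
    also have "\<dots> = ennreal h * indicator {0<..} y"
      using h by (simp add: nn_integral_cmult mult.commute)
    finally show "(\<integral>\<^sup>+x. indicator {0<..} x * indicator {y - h..<y} x \<partial>lborel)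
        \<le> ennreal h * indicator {0<..} y" .
  qed
  also have "\<dots> = ennreal h * emeasure \<mu> {0<..}"
    by (simp add: nn_integral_cmult)
  finally show ?thesis
    by (simp add: mult_left_mono)
qed

text \<open>By continuity \<open>k\<close> exceeds \<open>k y - e\<close> on every short window
  ending at \<open>y\<close>, and \<open>0 < y\<close> keeps such windows positive. A lower bound is
  what Fatou's lemma calls for.\<close>

lemma ennreal_le_liminf_averages:
  fixes k :: "real \<Rightarrow> real" and y :: real
  assumes y: "0 < y" and cont: "isCont k y"
  shows "ennreal (k y) \<le> liminf (\<lambda>n. of_nat (Suc n) *
           (\<integral>\<^sup>+x. ennreal (k x) * indicator {0<..} x * indicator {y - 1 / real (Suc n)..<y} x \<partial>lborel))"
    (is "_ \<le> liminf ?L")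
proof (rule ennreal_le_epsilon)
  fix e :: real assume e: "0 < e"
  obtain d where d: "0 < d" "\<And>x. \<bar>x - y\<bar> < d \<Longrightarrow> \<bar>k x - k y\<bar> < e"
    using cont e unfolding continuous_at_eps_delta dist_real_def by metis
  have "\<forall>\<^sub>F n in sequentially. 1 / real (Suc n) < min d y"
    using d y
    by (intro order_tendstoD(2)[OF LIMSEQ_Suc[OF lim_1_over_n]]) auto
  then have "\<forall>\<^sub>F n in sequentially. ennreal (k y - e) \<le> ?L n"
  proof eventually_elim
    case (elim n)
    let ?h = "1 / real (Suc n)"
    have "ennreal (k y - e) = of_nat (Suc n) * (ennreal (k y - e) * ennreal ?h)"
      by (simp add: ennreal_of_nat_eq_real_of_nat ennreal_mult''[symmetric] ennreal_mult'[symmetric]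
          del: of_nat_Suc)
    also have "\<dots> = of_nat (Suc n) * (\<integral>\<^sup>+x. ennreal (k y - e) * indicator {y - ?h..<y} x \<partial>lborel)"
      by (simp add: nn_integral_cmult)
    also have "\<dots> \<le> ?L n"
    proof (intro mult_left_mono nn_integral_mono)
      fix x
      show "ennreal (k y - e) * indicator {y - ?h..<y} x
          \<le> ennreal (k x) * indicator {0<..} x * indicator {y - ?h..<y} x"
      proof (cases "x \<in> {y - ?h..<y}")
        case True
        then have "\<bar>x - y\<bar> < d" "0 < x" using elim by auto
        with d(2)[of x] show ?thesis using True by (auto intro!: ennreal_leI)
      qed simp
    qed simp
    finally show ?case .
  qed
  then have le: "ennreal (k y - e) \<le> liminf ?L"
    by (rule Liminf_bounded)
  \<comment> \<open>\<open>k y - e\<close> may be negative, where \<open>ennreal\<close> truncates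
    to 0; hence the positive part.\<close>
  have "ennreal (k y) \<le> ennreal (max 0 (k y - e) + e)"
    by (intro ennreal_leI) auto
  also have "\<dots> = ennreal (k y - e) + ennreal e"
    using e by (simp add: ennreal_plus max_def ennreal_neg)
  also have "\<dots> \<le> liminf ?L + ennreal e"
    by (intro add_right_mono le)
  finally show "ennreal (k y) \<le> liminf ?L + ennreal e" .
qed

text \<open>The smoothed bound has the same constant for every window width, so Fatou's lemma along
  widths \<open>1 / Suc n\<close> removes the smoothing. Continuity almost everywhere leaves room
  for the singularity of the kernel.\<close>

lemma nn_integral_half_line_le:
  fixes \<mu> :: "real measure" and k :: "real \<Rightarrow> real" and C :: real
  assumes \<mu>: "finite_measure \<mu>" and sets[measurable_cong]: "sets \<mu> = sets borel"
    and C: "0 < C"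
    and k: "\<And>b. 0 < b \<Longrightarrow> (\<integral>\<^sup>+x. ennreal (k x) * indicator {0<..b} x \<partial>lborel) \<le> ennreal C * ennreal b"
    and [measurable]: "k \<in> borel_measurable borel"
    and cont: "AE y in \<mu>. 0 < y \<longrightarrow> isCont k y"
    and incr: "\<And>h x y. 0 < h \<Longrightarrow> 0 < x \<Longrightarrow> x \<le> y \<Longrightarrow> measure \<mu> {y<..y + h} \<le> measure \<mu> {x<..x + h}"
  shows "(\<integral>\<^sup>+y. ennreal (k y) * indicator {0<..} y \<partial>\<mu>) \<le> ennreal C * emeasure \<mu> {0<..}"
proof -
  interpret finite_measure \<mu> by fact
  let ?I = "\<lambda>n y. \<integral>\<^sup>+x. ennreal (k x) * indicator {0<..} x * indicator {y - 1 / real (Suc n)..<y} x \<partial>lborel"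
  have "(\<integral>\<^sup>+y. ennreal (k y) * indicator {0<..} y \<partial>\<mu>)
      \<le> (\<integral>\<^sup>+y. liminf (\<lambda>n. of_nat (Suc n) * ?I n y) \<partial>\<mu>)"
    using cont
  proof (intro nn_integral_mono_AE, eventually_elim)
    case (elim y)
    then show ?case
      using ennreal_le_liminf_averages[of y k] by (auto split: split_indicator)
  qed
  also have "\<dots> \<le> liminf (\<lambda>n. \<integral>\<^sup>+y. of_nat (Suc n) * ?I n y \<partial>\<mu>)"
    by (intro nn_integral_liminf) measurable
  also have "\<dots> \<le> liminf (\<lambda>n. ennreal C * emeasure \<mu> {0<..})"
  proof (intro Liminf_mono always_eventually allI)
    fix n
    have "(\<integral>\<^sup>+y. of_nat (Suc n) * ?I n y \<partial>\<mu>) = of_nat (Suc n) * (\<integral>\<^sup>+y. ?I n y \<partial>\<mu>)"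
      by (intro nn_integral_cmult) measurable
    also have "\<dots> \<le> of_nat (Suc n) * (ennreal C * (ennreal (1 / real (Suc n)) * emeasure \<mu> {0<..}))"
      by (intro mult_left_mono nn_integral_smoothed_le[OF \<mu> sets C _ k _ incr]) auto
    also have "\<dots> = (of_nat (Suc n) * ennreal (1 / real (Suc n))) * (ennreal C * emeasure \<mu> {0<..})"
      by (simp only: ac_simps)
    also have "of_nat (Suc n) * ennreal (1 / real (Suc n)) = 1"
      by (simp add: ennreal_of_nat_eq_real_of_nat ennreal_mult'[symmetric] del: of_nat_Suc)
    finally show "(\<integral>\<^sup>+y. of_nat (Suc n) * ?I n y \<partial>\<mu>) \<le> ennreal C * emeasure \<mu> {0<..}"
      by simp
  qed
  also have "\<dots> = ennreal C * emeasure \<mu> {0<..}"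
    by (simp add: Liminf_const)
  finally show ?thesis .
qed

section \<open>The moment bound for unimodal laws\<close>

text \<open>Both \<open>x + h\<close> and \<open>y\<close> are convex combinations of
  \<open>x\<close> and \<open>y + h\<close>, with weights \<open>t\<close> and \<open>1 - t\<close>
  interchanged. Adding the two concavity inequalities makes the weights cancel.\<close>

lemma concave_on_increment_antimono:
  fixes G :: "real \<Rightarrow> real"
  assumes G: "concave_on S G" and S: "x \<in> S" "y + h \<in> S" and "x \<le> y" "0 < h"
  shows "G (y + h) - G y \<le> G (x + h) - G x"
proof -
  define t where "t = h / (y + h - x)"
  have t: "0 \<le> t" "t \<le> 1" and th: "t * (y + h - x) = h"
    using assms by (auto simp: t_def field_simps)
  have "x + h = (1 - t) * x + t * (y + h)" "y = (1 - (1 - t)) * x + (1 - t) * (y + h)"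
    using th by (simp_all add: algebra_simps)
  then have "(1 - t) * G x + t * G (y + h) \<le> G (x + h)"
      "(1 - (1 - t)) * G x + (1 - t) * G (y + h) \<le> G y"
    using concave_onD[OF G t S] concave_onD[OF G _ _ S, of "1 - t"] t
    by (metis real_scaleR_def, metis diff_ge_0_iff_ge diff_le_eq le_add_same_cancel1 real_scaleR_def)
  then show ?thesis by (simp add: algebra_simps)
qed

text \<open>The half-line bound holds with one constant on each side of the mode, the left side
  after reflection, and the masses of the two sides add up to at most 1.\<close>

lemma nn_integral_unimodal_ratio_le:
  fixes F :: "real measure" and \<theta> t s :: real
  assumes F: "real_distribution F" and mode: "is_mode F \<theta>"
    and null: "\<And>x. emeasure F {x} = 0" and s: "0 < s" "s < 1"
  shows "(\<integral>\<^sup>+x. ennreal (\<bar>(x - \<theta>) / (x - t)\<bar> powr s) \<partial>F) \<le> ennreal ((1 + s) / (1 - s))"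
proof -
  interpret real_distribution F by fact
  define C where "C = 2 powr s / (1 - s)"
  have C: "0 < C" using s by (simp add: C_def)
  \<comment> \<open>The chord of \<open>exp\<close> between 0 and \<open>ln 2\<close> has height
    \<open>(1 - s) * 1 + s * 2\<close> at \<open>s * ln 2\<close>.\<close>
  have "2 powr s \<le> 1 + s"
    using convex_onD[OF exp_convex, of s 0 "ln 2"] s by (simp add: powr_def)
  then have C_le: "C \<le> (1 + s) / (1 - s)"
    using s by (simp add: C_def divide_right_mono)
  let ?q = "\<lambda>c x. \<bar>x / (x - c)\<bar> powr s"
  \<comment> \<open>\<open>T\<close> stands for the shift \<open>x - \<theta>\<close> and for the
    reflection \<open>\<theta> - x\<close>.\<close>
  have half: "(\<integral>\<^sup>+x. ennreal (?q c (T x)) * indicator {0<..} (T x) \<partial>F)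
        \<le> ennreal C * emeasure F {x. 0 < T x}"
    if [measurable]: "T \<in> borel_measurable borel"
      and inj: "\<And>y. emeasure F (T -` {y}) = 0"
      and incr: "\<And>h x y. 0 < h \<Longrightarrow> 0 < x \<Longrightarrow> x \<le> y \<Longrightarrow>
        measure F (T -` {y<..y + h}) \<le> measure F (T -` {x<..x + h})"
    for T c
  proof -
    let ?\<mu> = "distr F borel T"
    interpret D: prob_space ?\<mu> by (rule prob_space_distr) simp
    have "AE x in ?\<mu>. x \<noteq> c"
      using inj[of c] by (intro AE_I[of _ _ "{c}"]) (auto simp: emeasure_distr)
    \<comment> \<open>For \<open>0 < x\<close> and \<open>x \<noteq> c\<close> the base of the power
      is nonzero, so \<open>c\<close> is the only possible discontinuity, and it is a null
      point.\<close>
    then have cont: "AE x in ?\<mu>. 0 < x \<longrightarrow> isCont (?q c) x"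
      by eventually_elim (auto intro!: continuous_intros)
    have "(\<integral>\<^sup>+x. ennreal (?q c x) * indicator {0<..} x \<partial>?\<mu>) \<le> ennreal C * emeasure ?\<mu> {0<..}"
      by (rule nn_integral_half_line_le[OF D.finite_measure_axioms _ C _ _ cont])
         (use incr nn_integral_ratio_powr_le[OF s] in \<open>auto simp: C_def measure_distr simp del: abs_divide\<close>)
    then show ?thesis
      by (simp add: nn_integral_distr emeasure_distr vimage_def)
  qed
  have m: "measure F {a<..b} = cdf F b - cdf F a" if "a < b" for a b
    using cdf_diff_eq[OF that] by simp
  have right: "(\<integral>\<^sup>+x. ennreal (?q (t - \<theta>) (x - \<theta>)) * indicator {0<..} (x - \<theta>) \<partial>F)
      \<le> ennreal C * emeasure F {x. 0 < x - \<theta>}"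
  proof (rule half)
    fix y
    have "(\<lambda>x. x - \<theta>) -` {y} = {y + \<theta>}" by auto
    then show "emeasure F ((\<lambda>x. x - \<theta>) -` {y}) = 0" using null by simp
  next
    fix h x y :: real assume *: "0 < h" "0 < x" "x \<le> y"
    have v: "(\<lambda>x. x - \<theta>) -` {z<..z + h} = {z + \<theta><..z + \<theta> + h}" for z by auto
    show "measure F ((\<lambda>x. x - \<theta>) -` {y<..y + h}) \<le> measure F ((\<lambda>x. x - \<theta>) -` {x<..x + h})"
      unfolding v
      using * mode concave_on_increment_antimono[of "{\<theta>..}" "cdf F" "x + \<theta>" "y + \<theta>" h]
      by (simp add: m is_mode_def)
  qed simp
  have left: "(\<integral>\<^sup>+x. ennreal (?q (\<theta> - t) (\<theta> - x)) * indicator {0<..} (\<theta> - x) \<partial>F)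
      \<le> ennreal C * emeasure F {x. 0 < \<theta> - x}"
  proof (rule half)
    fix y
    have "(\<lambda>x. \<theta> - x) -` {y} = {\<theta> - y}" by auto
    then show "emeasure F ((\<lambda>x. \<theta> - x) -` {y}) = 0" using null by simp
  next
    fix h x y :: real assume *: "0 < h" "0 < x" "x \<le> y"
    \<comment> \<open>Reflection swaps the open and closed ends; the endpoints are null, so the
      interval can again be read as an increment of \<open>cdf F\<close>.\<close>
    have v: "measure F ((\<lambda>x. \<theta> - x) -` {z<..z + h}) = measure F {\<theta> - z - h<..\<theta> - z}" for z
    proof (rule measure_eq_AE)
      have "AE u in F. u \<noteq> w" for w
        using null[of w] by (intro AE_I[of _ _ "{w}"]) auto
      from this[of "\<theta> - z"] this[of "\<theta> - z - h"]
      show "AE u in F. u \<in> (\<lambda>x. \<theta> - x) -` {z<..z + h} \<longleftrightarrow> u \<in> {\<theta> - z - h<..\<theta> - z}"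
        by eventually_elim auto
    next
      have "(\<lambda>x. \<theta> - x) -` {z<..z + h} = {\<theta> - z - h..<\<theta> - z}" by auto
      then show "(\<lambda>x. \<theta> - x) -` {z<..z + h} \<in> sets F" by simp
    qed simp
    show "measure F ((\<lambda>x. \<theta> - x) -` {y<..y + h}) \<le> measure F ((\<lambda>x. \<theta> - x) -` {x<..x + h})"
      unfolding v
      using * mode concave_on_increment_antimono[of "{..\<theta>}" "\<lambda>x. - cdf F x" "\<theta> - y - h" "\<theta> - x - h" h]
      by (simp add: m is_mode_def concave_on_def)
  qed simp
  \<comment> \<open>At \<open>x = \<theta>\<close> both indicators vanish, and so does the left
    integrand because \<open>0 powr s = 0\<close>.\<close>
  have "(\<integral>\<^sup>+x. ennreal (\<bar>(x - \<theta>) / (x - t)\<bar> powr s) \<partial>F)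
      = (\<integral>\<^sup>+x. ennreal (?q (t - \<theta>) (x - \<theta>)) * indicator {0<..} (x - \<theta>)
            + ennreal (?q (\<theta> - t) (\<theta> - x)) * indicator {0<..} (\<theta> - x) \<partial>F)"
  proof (intro nn_integral_cong)
    fix x
    have "\<bar>(\<theta> - x) / ((\<theta> - x) - (\<theta> - t))\<bar> = \<bar>(x - \<theta>) / (x - t)\<bar>"
      by (simp add: abs_divide abs_minus_commute)
    then show "ennreal (\<bar>(x - \<theta>) / (x - t)\<bar> powr s)
      = ennreal (?q (t - \<theta>) (x - \<theta>)) * indicator {0<..} (x - \<theta>)
            + ennreal (?q (\<theta> - t) (\<theta> - x)) * indicator {0<..} (\<theta> - x)"
      by (cases x \<theta> rule: linorder_cases) auto
  qed
  also have "\<dots> \<le> ennreal C * emeasure F {x. 0 < x - \<theta>} + ennreal C * emeasure F {x. 0 < \<theta> - x}"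
    by (rule ord_eq_le_trans[OF nn_integral_add add_mono[OF right left]]) measurable
  also have "\<dots> = ennreal C * (emeasure F {x. 0 < x - \<theta>} + emeasure F {x. 0 < \<theta> - x})"
    by (simp only: distrib_left)
  also have "emeasure F {x. 0 < x - \<theta>} + emeasure F {x. 0 < \<theta> - x}
      = emeasure F ({x. 0 < x - \<theta>} \<union> {x. 0 < \<theta> - x})"
    by (rule plus_emeasure) auto
  also have "ennreal C * \<dots> \<le> ennreal C * 1"
    by (intro mult_left_mono emeasure_le_1) auto
  also have "\<dots> \<le> ennreal ((1 + s) / (1 - s))"
    using C_le by (simp add: ennreal_leI)
  finally show ?thesis .
qed

section \<open>Independent estimate and coverage\<close>

text \<open>Independence makes the joint law a product, so integrating over \<open>W\<close> first
  freezes the estimate at a constant \<open>T v\<close>; the moment bound is uniform in that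
  constant. The map \<open>\<pi>\<close> reads the observation off a sub-sample, here a one-point
  one.\<close>

lemma (in prob_space) nn_integral_plug_in_ratio_le:
  fixes F :: "real measure" and \<theta> s :: real and T \<pi> :: "'b \<Rightarrow> real"
  assumes indep: "indep_var N V N' W" and W: "distr M borel (\<lambda>\<omega>. \<pi> (W \<omega>)) = F"
    and [measurable]: "T \<in> borel_measurable N" "\<pi> \<in> borel_measurable N'"
    and F: "real_distribution F" "is_mode F \<theta>" "\<And>x. emeasure F {x} = 0"
    and s: "0 < s" "s < 1"
  shows "(\<integral>\<^sup>+\<omega>. ennreal (\<bar>(\<pi> (W \<omega>) - \<theta>) / (\<pi> (W \<omega>) - T (V \<omega>))\<bar> powr s) \<partial>M)
           \<le> ennreal ((1 + s) / (1 - s))"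
proof -
  have rv[measurable]: "random_variable N V" "random_variable N' W"
    and joint: "distr M N V \<Otimes>\<^sub>M distr M N' W = distr M (N \<Otimes>\<^sub>M N') (\<lambda>\<omega>. (V \<omega>, W \<omega>))"
    using indep unfolding indep_var_distribution_eq by auto
  interpret V: prob_space "distr M N V" by (rule prob_space_distr) simp
  interpret W: prob_space "distr M N' W" by (rule prob_space_distr) simp
  have F_eq: "F = distr (distr M N' W) borel \<pi>"
    by (simp add: W[symmetric] distr_distr comp_def)
  let ?k = "\<lambda>(v, w). ennreal (\<bar>(\<pi> w - \<theta>) / (\<pi> w - T v)\<bar> powr s)"
  have "(\<integral>\<^sup>+\<omega>. ennreal (\<bar>(\<pi> (W \<omega>) - \<theta>) / (\<pi> (W \<omega>) - T (V \<omega>))\<bar> powr s) \<partial>M)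
      = (\<integral>\<^sup>+p. ?k p \<partial>distr M (N \<Otimes>\<^sub>M N') (\<lambda>\<omega>. (V \<omega>, W \<omega>)))"
    by (subst nn_integral_distr) auto
  also have "\<dots> = (\<integral>\<^sup>+v. \<integral>\<^sup>+w. ?k (v, w) \<partial>distr M N' W \<partial>distr M N V)"
    unfolding joint[symmetric] by (rule W.nn_integral_fst[symmetric]) measurable
  also have "\<dots> = (\<integral>\<^sup>+v. \<integral>\<^sup>+x. ennreal (\<bar>(x - \<theta>) / (x - T v)\<bar> powr s) \<partial>F \<partial>distr M N V)"
    unfolding F_eq by (subst nn_integral_distr[of \<pi> "distr M N' W" borel]) auto
  also have "\<dots> \<le> (\<integral>\<^sup>+v. ennreal ((1 + s) / (1 - s)) \<partial>distr M N V)"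
    using nn_integral_unimodal_ratio_le[OF F s] by (intro nn_integral_mono) simp
  also have "\<dots> = ennreal ((1 + s) / (1 - s))"
    using V.emeasure_space_1 by simp
  finally show ?thesis .
qed

theorem theorem10:
  fixes M :: "'a measure" and F :: "real measure" and f :: "real \<Rightarrow> real"
    and \<theta>\<^sub>0 \<alpha> \<rho> :: real and m n :: nat
    and X :: "nat \<Rightarrow> nat \<Rightarrow> 'a \<Rightarrow> real"
    and S\<^sub>1 S\<^sub>2 :: "nat \<Rightarrow> nat set"
    and T :: "nat \<Rightarrow> (nat \<Rightarrow> real) \<Rightarrow> real"
  assumes "prob_space M"
    and "real_distribution F"
    and "has_density F f"
    and "unique_mode F \<theta>\<^sub>0"
    and "\<And>k i. i \<in> {1..k} \<Longrightarrow> X k i \<in> borel_measurable M"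
    and "\<And>k i. i \<in> {1..k} \<Longrightarrow> distr M borel (X k i) = F"
    and "\<And>k. sample_split k (S\<^sub>1 k) (S\<^sub>2 k)"
    and "\<And>k. T k \<in> borel_measurable (PiM (S\<^sub>1 k) (\<lambda>_. borel))"
    and "consistent M (\<lambda>k \<omega>. T k (subsample (S\<^sub>1 k) (X k) \<omega>)) \<theta>\<^sub>0"
    and "card (S\<^sub>1 m) = m - n" and "card (S\<^sub>2 m) = n" and "n \<ge> 1"
    and "\<And>i. i \<in> S\<^sub>2 m \<Longrightarrow>
           prob_space.indep_var M
             (PiM (S\<^sub>1 m) (\<lambda>_. borel)) (subsample (S\<^sub>1 m) (X m))
             (PiM {i} (\<lambda>_. borel)) (subsample {i} (X m))"
    and "0 < \<alpha>" and "\<alpha> < 1" and "1 < \<rho>"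
  shows "measure M {\<omega> \<in> space M.
           \<theta>\<^sub>0 \<in> edelman_CS (S\<^sub>2 m) n \<alpha> \<rho> (subsample (S\<^sub>2 m) (X m) \<omega>)
                   (T m (subsample (S\<^sub>1 m) (X m) \<omega>))}
         \<ge> 1 - \<alpha>"
proof -
  interpret prob_space M by fact
  define s where "s = 1 / \<rho>"
  define R where "R \<omega> i = \<bar>(X m i \<omega> - \<theta>\<^sub>0) / (X m i \<omega> - T m (subsample (S\<^sub>1 m) (X m) \<omega>))\<bar> powr s"
    for \<omega> i
  define c where "c = 1 / real n * ((\<rho> - 1) / (\<rho> + 1))"
  have s: "0 < s" "s < 1" and ratio: "(1 + s) / (1 - s) = (\<rho> + 1) / (\<rho> - 1)"
    using \<open>1 < \<rho>\<close> by (auto simp: s_def field_simps)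
  \<comment> \<open>The normalisation turns \<open>n\<close> copies of the moment bound into 1, so
    that the statistic has mean at most 1.\<close>
  have c: "0 \<le> c" "c * (real n * ((1 + s) / (1 - s))) = 1"
    using \<open>1 < \<rho>\<close> \<open>n \<ge> 1\<close> unfolding ratio by (auto simp: c_def)
  have S: "S\<^sub>1 m \<subseteq> {1..m}" "S\<^sub>2 m \<subseteq> {1..m}"
    using assms(7)[of m] by (auto simp: sample_split_def)
  have X_meas[measurable]: "X m i \<in> borel_measurable M" if "i \<in> {1..m}" for i
    using assms(5) that .
  have T_meas[measurable]: "(\<lambda>\<omega>. T m (subsample (S\<^sub>1 m) (X m) \<omega>)) \<in> borel_measurable M"
  proof (rule measurable_compose[OF _ assms(8)])
    show "subsample (S\<^sub>1 m) (X m) \<in> measurable M (PiM (S\<^sub>1 m) (\<lambda>_. borel))"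
      unfolding subsample_def using S X_meas by (intro measurable_restrict) auto
  qed
  have R_meas[measurable]: "(\<lambda>\<omega>. R \<omega> i) \<in> borel_measurable M" if "i \<in> S\<^sub>2 m" for i
    using X_meas[of i] that S unfolding R_def by auto
  have null: "emeasure F {x} = 0" for x
    using assms(3) by (auto simp: has_density_def emeasure_density)
  have mode: "is_mode F \<theta>\<^sub>0"
    using assms(4) by (simp add: unique_mode_def)
  have R_le: "(\<integral>\<^sup>+\<omega>. ennreal (R \<omega> i) \<partial>M) \<le> ennreal ((1 + s) / (1 - s))" if i: "i \<in> S\<^sub>2 m" for i
  proof -
    have "distr M borel (\<lambda>\<omega>. subsample {i} (X m) \<omega> i) = F"
      using assms(6)[of i m] S i by (auto simp: subsample_def)
    from nn_integral_plug_in_ratio_le[OF assms(13)[OF i] this assms(8) _ assms(2) mode null s]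
    show ?thesis by (simp add: R_def subsample_def)
  qed
  let ?Z = "\<lambda>\<omega>. c * (\<Sum>i\<in>S\<^sub>2 m. R \<omega> i)"
  \<comment> \<open>Linearity of the integral allows arbitrary dependence among the observations in
    \<open>S\<^sub>2 m\<close>.\<close>
  have "(\<integral>\<^sup>+\<omega>. ennreal (?Z \<omega>) \<partial>M) = ennreal c * (\<Sum>i\<in>S\<^sub>2 m. \<integral>\<^sup>+\<omega>. ennreal (R \<omega> i) \<partial>M)"
  proof -
    have "(\<integral>\<^sup>+\<omega>. ennreal (?Z \<omega>) \<partial>M) = (\<integral>\<^sup>+\<omega>. ennreal c * (\<Sum>i\<in>S\<^sub>2 m. ennreal (R \<omega> i)) \<partial>M)"
      using c by (simp add: ennreal_mult' R_def sum_ennreal)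
    also have "\<dots> = ennreal c * (\<integral>\<^sup>+\<omega>. (\<Sum>i\<in>S\<^sub>2 m. ennreal (R \<omega> i)) \<partial>M)"
      by (intro nn_integral_cmult) measurable
    also have "(\<integral>\<^sup>+\<omega>. (\<Sum>i\<in>S\<^sub>2 m. ennreal (R \<omega> i)) \<partial>M) = (\<Sum>i\<in>S\<^sub>2 m. \<integral>\<^sup>+\<omega>. ennreal (R \<omega> i) \<partial>M)"
      by (intro nn_integral_sum) measurable
    finally show ?thesis .
  qed
  also have "\<dots> \<le> ennreal c * (\<Sum>i\<in>S\<^sub>2 m. ennreal ((1 + s) / (1 - s)))"
    by (intro mult_left_mono sum_mono R_le) auto
  also have "\<dots> = ennreal (c * (real n * ((1 + s) / (1 - s))))"
    using c(1) s by (simp add: assms(11) ennreal_mult' ennreal_of_nat_eq_real_of_nat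
        del: times_divide_eq_right)
  finally have Z_le: "(\<integral>\<^sup>+\<omega>. ennreal (?Z \<omega>) \<partial>M) \<le> 1"
    by (simp only: c(2) ennreal_1)
  have Z_meas[measurable]: "?Z \<in> borel_measurable M" by measurable
  \<comment> \<open>The event \<open>1 / \<alpha> \<le> ?Z \<omega>\<close> in the form of Markov's
    inequality. As the confidence set uses a strict inequality, coverage is exactly its
    complement.\<close>
  let ?B = "{\<omega> \<in> space M. 1 \<le> ennreal \<alpha> * ennreal (?Z \<omega>)}"
  have "emeasure M ?B \<le> ennreal \<alpha> * (\<integral>\<^sup>+\<omega>. ennreal (?Z \<omega>) * indicator (space M) \<omega> \<partial>M)"
    using nn_integral_Markov_inequality[of "\<lambda>\<omega>. ennreal (?Z \<omega>)" "space M" M "ennreal \<alpha>"] by simp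
  also have "\<dots> \<le> ennreal \<alpha> * 1"
    using Z_le by (intro mult_left_mono) (auto cong: nn_integral_cong)
  finally have B: "measure M ?B \<le> \<alpha>"
    using \<open>0 < \<alpha>\<close> by (simp add: emeasure_eq_measure)
  have "{\<omega> \<in> space M. \<theta>\<^sub>0 \<in> edelman_CS (S\<^sub>2 m) n \<alpha> \<rho> (subsample (S\<^sub>2 m) (X m) \<omega>)
                   (T m (subsample (S\<^sub>1 m) (X m) \<omega>))} = {\<omega> \<in> space M. ?Z \<omega> < 1 / \<alpha>}"
    by (simp add: edelman_CS_def subsample_def R_def s_def c_def)
  also have "\<dots> = space M - ?B"
  proof -
    have "1 \<le> ennreal \<alpha> * ennreal (?Z \<omega>) \<longleftrightarrow> \<not> ?Z \<omega> < 1 / \<alpha>" for \<omega>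
    proof -
      have "ennreal \<alpha> * ennreal (?Z \<omega>) = ennreal (\<alpha> * ?Z \<omega>)"
        using \<open>0 < \<alpha>\<close> by (intro ennreal_mult'[symmetric]) simp
      then show ?thesis using \<open>0 < \<alpha>\<close> by (simp add: field_simps not_less)
    qed
    then show ?thesis by auto
  qed
  finally show ?thesis
    using B by (simp add: prob_compl)
qed

end
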